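(* Let $q$ be any fixed odd prime power, and for integers $g\ge1$ let $$ \mathcal S_{\mathrm{nr}}(g)=\frac{2q^{2g/3-1/3}}9\operatorname{Re}\!\left[\omega^{g+1}\left(2z_1\Phi'(z_1)-(g+1)\Phi(z_1)\right)\right]. $$ There are at least two residue classes $m\bmod3$ for which there is a constant $c_{q,m}>0$ with $$ |\mathcal S_{\mathrm{nr}}(g)|\ge c_{q,m}\,g\,q^{2g/3} $$ for all sufficiently large $g\equiv m\bmod3$. In particular $\mathcal S_{\mathrm{nr}}$ is not identically zero.
   Context: Let $\mathcal P$ be the set of monic irreducible polynomials in $\mathbb F_q[T]$; for $P\in\mathcal P$ put $d(P)=\deg P$ and $|P|=q^{d(P)}$. For $P\in\mathcal P$ with $d=d(P)$ put $$ D_P(z,w)=1+\frac{1}{(|P|^2z^d-1)(1+w^d)} \Bigl\{-w^{2d}-\frac{w^{3d}}{|P|}+\frac{w^d}{|P|^2z^d}+|P|(w^2z)^d+(w^2z)^d-|P|^2(wz^2)^d+(w^3z)^d-|P|^2(w^2z^2)^d\Bigr\}. $$ The product $\prod_{P\in\mathcal P}D_P(z,qz)$ converges absolutely and locally uniformly for $q^{-2}<|z|<q^{-1}$; on this annulus define the holomorphic function $$ \Phi(z)=\frac{\left(1-\frac1{qz}\right)(1-q^3z^2)\prod_{P\in\mathcal P}D_P(z,qz)}{(1-z)(1-q^2z)}. $$ Let $\omega=e^{2\pi i/3}$ and $z_1=q^{-4/3}\omega$. *)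

theory Defs
  imports
    "HOL-Analysis.Analysis"
    "HOL-Computational_Algebra.Computational_Algebra"
begin

text \<open>
  The finite field with \<open>q\<close> elements is a type \<open>'a\<close> of sort \<open>{finite, field}\<close>, and \<open>q\<close> is
  \<open>CARD('a)\<close>. Quantities that depend only on this field take an argument of type \<open>'a itself\<close>.
\<close>

definition monic_irreducibles :: "'a::{finite,field} poly set" where
  "monic_irreducibles = {P. lead_coeff P = 1 \<and> irreducible P}"

definition poly_abs :: "'a::{finite,field} poly \<Rightarrow> complex" where
  "poly_abs P = of_nat (CARD('a) ^ degree P)"

definition local_factor :: "'a::{finite,field} poly \<Rightarrow> complex \<Rightarrow> complex \<Rightarrow> complex" where
  "local_factor P z w =
    (let d = degree P; N = poly_abs P in
      1 + 1 / ((N^2 * z^d - 1) * (1 + w^d)) *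
        (-(w^(2*d)) - w^(3*d) / N + w^d / (N^2 * z^d) + N * (w^2 * z)^d + (w^2 * z)^d
         - N^2 * (w * z^2)^d + (w^3 * z)^d - N^2 * (w^2 * z^2)^d))"

text \<open>
  Unordered product over an arbitrary index set: the limit of the finite subproducts, the
  multiplicative analogue of \<open>infsum\<close>. It is unspecified if that limit does not exist.
\<close>

definition unordered_prod :: "('i \<Rightarrow> complex) \<Rightarrow> 'i set \<Rightarrow> complex" where
  "unordered_prod f A = Lim (finite_subsets_at_top A) (prod f)"

text \<open>
  Only the values on the annulus \<open>q\<^sup>-\<^sup>2 < \<bar>z\<bar> < q\<^sup>-\<^sup>1\<close>, where the product converges
  absolutely, are meaningful. The annulus is open and contains \<open>z\<^sub>1\<close>, so the derivative
  at \<open>z\<^sub>1\<close> does not depend on the values elsewhere.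
\<close>

definition Phi :: "'a::{finite,field} itself \<Rightarrow> complex \<Rightarrow> complex" where
  "Phi _ z =
    (let q = (of_nat CARD('a) :: complex) in
      (1 - 1 / (q * z)) * (1 - q^3 * z^2)
        * unordered_prod (\<lambda>P. local_factor P z (q * z)) (monic_irreducibles :: 'a poly set)
      / ((1 - z) * (1 - q^2 * z)))"

definition omega :: complex where
  "omega = exp (2 * of_real pi * \<i> / 3)"

definition z1 :: "'a::{finite,field} itself \<Rightarrow> complex" where
  "z1 _ = of_real (real CARD('a) powr (- 4 / 3)) * omega"

definition S_nr :: "'a::{finite,field} itself \<Rightarrow> nat \<Rightarrow> real" where
  "S_nr F g =
    2 * real CARD('a) powr (2 * real g / 3 - 1 / 3) / 9 *
      Re (omega ^ (g + 1) *
        (2 * z1 F * deriv (Phi F) (z1 F) - of_nat (g + 1) * Phi F (z1 F)))"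

end

theory Submission
  imports Defs
begin

text \<open>
  Only \<open>\<Phi>(z\<^sub>1) \<noteq> 0\<close> has to be shown: the three rotations \<open>\<omega>\<^sup>k \<Phi>(z\<^sub>1)\<close> of a nonzero
  number cannot include two purely imaginary ones, and for the other classes the term
  \<open>(g + 1) Re (\<omega>\<^bsup>g+1\<^esup> \<Phi>(z\<^sub>1))\<close> dominates the bounded contribution of \<open>\<Phi>'(z\<^sub>1)\<close>.
  With \<open>a = q\<^bsup>-d/3\<^esup>\<close> and \<open>u = \<omega>\<^sup>d\<close> the relation \<open>u\<^sup>3 = 1\<close> collapses the local factor at
  \<open>z\<^sub>1\<close> to \<open>(1 - a\<^sup>3) u (1 - a\<^sup>6 + a u - a\<^sup>2 u\<^sup>2) / ((u - a\<^sup>2) (1 + a u))\<close>. This is nonzero and differs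
  from 1 by \<open>O(a\<^sup>4)\<close>, which is summable because there are at most \<open>q\<^sup>d = a\<^bsup>-3\<^esup>\<close> monic polynomials
  of degree \<open>d\<close>; hence the product converges to a nonzero limit.
\<close>

section \<open>Nonvanishing of absolutely convergent products\<close>

text \<open>The product is the exponential of the sum of the principal logarithms, hence nonzero.
  The logarithms are summable because \<open>norm (Ln (1 + t))\<close> is at most
  \<open>2 * norm t\<close> for small \<open>t\<close>, and only the finite set \<open>B\<close> of
  factors far from 1 escapes this bound.\<close>

lemma unordered_prod_nonzero:
  fixes f :: "'i \<Rightarrow> complex"
  assumes summable: "(\<lambda>x. norm (f x - 1)) summable_on A"
    and nz: "\<And>x. x \<in> A \<Longrightarrow> f x \<noteq> 0"
  shows "unordered_prod f A \<noteq> 0"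
proof -
  define B where "B = {x \<in> A. norm (f x - 1) \<ge> 1/2}"
  have fin: "finite B"
  proof -
    \<comment> \<open>Each element of \<open>B\<close> contributes at least 1/2 to the convergent
      sum, so no finite subset has more than twice that sum many elements.\<close>
    have "card X \<le> nat \<lceil>2 * (\<Sum>\<^sub>\<infinity>x\<in>A. norm (f x - 1))\<rceil>" if X: "X \<subseteq> B" "finite X" for X
    proof -
      have "real (card X) * (1/2) \<le> (\<Sum>x\<in>X. norm (f x - 1))"
        using X by (intro sum_bounded_below) (auto simp: B_def)
      also have "\<dots> \<le> (\<Sum>\<^sub>\<infinity>x\<in>A. norm (f x - 1))"
        using X by (intro finite_sum_le_infsum[OF summable]) (auto simp: B_def)
      finally show ?thesis by linarith
    qed
    then show ?thesis using finite_if_finite_subsets_card_bdd by blast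
  qed
  have bound: "norm (Ln (f x)) \<le> 2 * norm (f x - 1)" if "x \<in> A - B" for x
    using norm_Ln_le[of "f x - 1"] that by (auto simp: B_def)
  have "(\<lambda>x. norm (Ln (f x))) summable_on (A - B)"
  proof (rule summable_on_comparison_test)
    show "(\<lambda>x. 2 * norm (f x - 1)) summable_on (A - B)"
      by (intro summable_on_cmult_right summable_on_subset_banach[OF summable]) auto
  qed (use bound in auto)
  then have "(\<lambda>x. Ln (f x)) summable_on (A - B)"
    by (rule abs_summable_summable)
  then have "(\<lambda>x. Ln (f x)) summable_on ((A - B) \<union> B)"
    using fin by (intro summable_on_Un_disjoint) auto
  also have "(A - B) \<union> B = A" by (auto simp: B_def)
  finally have "((\<lambda>x. Ln (f x)) has_sum (\<Sum>\<^sub>\<infinity>x\<in>A. Ln (f x))) A"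
    by (rule has_sum_infsum)
  then have "((\<lambda>X. exp (\<Sum>x\<in>X. Ln (f x))) \<longlongrightarrow> exp (\<Sum>\<^sub>\<infinity>x\<in>A. Ln (f x))) (finite_subsets_at_top A)"
    unfolding has_sum_def by (intro tendsto_exp)
  \<comment> \<open>The branch of the logarithm is immaterial here: \<open>exp\<close> undoes
    \<open>Ln\<close> at every nonzero argument, including those indexed by
    \<open>B\<close>.\<close>
  moreover have "\<forall>\<^sub>F X in finite_subsets_at_top A. exp (\<Sum>x\<in>X. Ln (f x)) = prod f X"
    using nz by (intro eventually_finite_subsets_at_top_weakI) (auto simp: exp_sum intro!: prod.cong)
  ultimately have "(prod f \<longlongrightarrow> exp (\<Sum>\<^sub>\<infinity>x\<in>A. Ln (f x))) (finite_subsets_at_top A)"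
    by (rule Lim_transform_eventually)
  then show ?thesis
    unfolding unordered_prod_def by (simp add: tendsto_Lim)
qed

section \<open>Counting monic polynomials by degree\<close>

lemma card_monic_of_degree:
  "finite {P :: 'a::{finite,field} poly. lead_coeff P = 1 \<and> degree P = d}"
  "card {P :: 'a::{finite,field} poly. lead_coeff P = 1 \<and> degree P = d} \<le> CARD('a) ^ d"
proof -
  let ?M = "{P :: 'a poly. lead_coeff P = 1 \<and> degree P = d}"
  let ?L = "{xs :: 'a list. set xs \<subseteq> UNIV \<and> length xs = d}"
  have sub: "?M \<subseteq> (\<lambda>xs. Poly (xs @ [1])) ` ?L"
  proof
    fix P :: "'a poly" assume P: "P \<in> ?M"
    then have "P \<noteq> 0" by auto
    then have len: "length (coeffs P) = Suc d" and last: "last (coeffs P) = 1"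
      using P by (auto simp: length_coeffs_degree last_coeffs_eq_coeff_degree)
    then have "coeffs P = butlast (coeffs P) @ [1]"
      by (metis append_butlast_last_id length_0_conv nat.distinct(1))
    then have "P = Poly (butlast (coeffs P) @ [1])"
      by (metis Poly_coeffs)
    then show "P \<in> (\<lambda>xs. Poly (xs @ [1])) ` ?L"
      using len by (intro image_eqI[of _ _ "butlast (coeffs P)"]) auto
  qed
  have fin: "finite ?L" by (rule finite_lists_length_eq) simp
  show "finite ?M" using finite_subset[OF sub] fin by blast
  have "card ?M \<le> card ?L" using sub fin by (rule surj_card_le[rotated])
  also have "\<dots> = CARD('a) ^ d" by (rule card_lists_length_eq) simp
  finally show "card ?M \<le> CARD('a) ^ d" .
qed

text \<open>Grouping a finite partial sum by degree bounds it by the geometric series of ratio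
  \<open>q * s\<close>. It is applied with \<open>s = r ^ 4\<close>, where
  \<open>q = 1 / r ^ 3\<close>, so that the ratio is \<open>r\<close>.\<close>

lemma summable_on_monic:
  fixes s :: real
  assumes "0 \<le> s" "real CARD('a::{finite,field}) * s < 1"
  shows "(\<lambda>P :: 'a poly. s ^ degree P) summable_on {P. lead_coeff P = 1}"
proof (rule nonneg_bounded_partial_sums_imp_summable_on)
  let ?q = "real CARD('a)"
  have sums: "summable (\<lambda>d. (?q * s) ^ d)"
    using assms by (intro summable_geometric) auto
  have "sum (\<lambda>P. s ^ degree P) F \<le> (\<Sum>d. (?q * s) ^ d)"
    if F: "finite F" "F \<subseteq> {P :: 'a poly. lead_coeff P = 1}" for F
  proof -
    have "sum (\<lambda>P. s ^ degree P) F = (\<Sum>d\<in>degree ` F. \<Sum>P\<in>{P \<in> F. degree P = d}. s ^ degree P)"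
      using F by (intro sum.image_gen)
    also have "\<dots> = (\<Sum>d\<in>degree ` F. real (card {P \<in> F. degree P = d}) * s ^ d)"
      by (intro sum.cong) auto
    also have "\<dots> \<le> (\<Sum>d\<in>degree ` F. (?q * s) ^ d)"
    proof (intro sum_mono)
      fix d
      have "card {P \<in> F. degree P = d} \<le> card {P :: 'a poly. lead_coeff P = 1 \<and> degree P = d}"
        using F by (intro card_mono card_monic_of_degree) auto
      also have "\<dots> \<le> CARD('a) ^ d" by (rule card_monic_of_degree)
      finally have "real (card {P \<in> F. degree P = d}) \<le> ?q ^ d"
        by (metis of_nat_le_iff of_nat_power)
      then show "real (card {P \<in> F. degree P = d}) * s ^ d \<le> (?q * s) ^ d"
        using assms by (simp add: power_mult_distrib mult_right_mono)
    qed
    also have "\<dots> \<le> (\<Sum>d. (?q * s) ^ d)"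
      using assms F by (intro sum_le_suminf[OF sums]) auto
    finally show ?thesis .
  qed
  then show "\<forall>\<^sub>F F in finite_subsets_at_top {P :: 'a poly. lead_coeff P = 1}.
      sum (\<lambda>P. s ^ degree P) F \<le> (\<Sum>d. (?q * s) ^ d)"
    by (intro eventually_finite_subsets_at_top_weakI)
qed (use assms in auto)

section \<open>Local factors at the critical point\<close>

lemma euler_factor_numerator_nonzero:
  fixes a :: real and u :: complex
  assumes a: "0 < a" "a < 1" and u: "u ^ 3 = 1"
  shows "1 - of_real a ^ 6 + of_real a * u - of_real a ^ 2 * u ^ 2 \<noteq> 0"
proof
  assume eq: "1 - of_real a ^ 6 + of_real a * u - of_real a ^ 2 * u ^ 2 = 0"
  have "(u - 1) * (u ^ 2 + u + 1) = 0"
    using u by (simp add: algebra_simps power2_eq_square power3_eq_cube)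
  then consider "u = 1" | "u ^ 2 + u + 1 = 0"
    by (metis eq_iff_diff_eq_0 mult_eq_0_iff)
  then show False
  proof cases
    case 1
    have "complex_of_real (1 - a ^ 6 + a - a ^ 2) = 0"
      using eq 1 by simp
    then have "1 - a ^ 6 + a - a ^ 2 = 0"
      by (simp only: of_real_eq_0_iff)
    moreover have "a ^ 6 < 1" "a ^ 2 < a"
      using a by (auto simp: power_less_one_iff power2_eq_square)
    ultimately show False by simp
  next
    case 2
    then have u2: "u ^ 2 = - 1 - u" by algebra
    \<comment> \<open>Eliminating \<open>u ^ 2\<close> leaves an affine expression in
      \<open>u\<close> with real coefficients; its imaginary part forces \<open>u\<close> to be
      real, which is impossible since \<open>x ^ 2 + x + 1\<close> has no real root.\<close>
    have "complex_of_real (1 - a ^ 6 + a ^ 2) + of_real (a + a ^ 2) * u = 0"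
      using eq u2 by (simp add: algebra_simps)
    then have "Im (complex_of_real (1 - a ^ 6 + a ^ 2) + of_real (a + a ^ 2) * u) = 0"
      by (simp only: zero_complex.sel)
    then have "(a + a ^ 2) * Im u = 0" by simp
    moreover have "a + a ^ 2 > 0" using a by (simp add: add_pos_pos)
    ultimately have "Im u = 0" by simp
    moreover have "Re (u ^ 2) = - 1 - Re u" using u2 by simp
    ultimately have "(Re u) ^ 2 + Re u + 1 = 0"
      by (simp add: power2_eq_square)
    moreover have "(Re u) ^ 2 + Re u + 1 = (Re u + 1/2) ^ 2 + 3/4"
      by (simp add: power2_eq_square algebra_simps)
    ultimately show False
      by (smt (verit) zero_le_power2 divide_pos_pos)
  qed
qed

text \<open>Every exponent in the factor is a multiple of the degree, so the factor is a rational
  function of \<open>N\<close>, \<open>Z\<close> and \<open>W\<close>, and later algebra is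
  independent of the degree.\<close>

lemma local_factor_eq:
  fixes P :: "'a::{finite,field} poly" and z w :: complex
  defines "N \<equiv> poly_abs P" and "Z \<equiv> z ^ degree P" and "W \<equiv> w ^ degree P"
  shows "local_factor P z w = 1 + 1 / ((N ^ 2 * Z - 1) * (1 + W)) *
    (- (W ^ 2) - W ^ 3 / N + W / (N ^ 2 * Z) + N * (W ^ 2 * Z) + W ^ 2 * Z - N ^ 2 * (W * Z ^ 2)
     + W ^ 3 * Z - N ^ 2 * (W ^ 2 * Z ^ 2))"
proof -
  have swap: "(x ^ numeral k) ^ degree P = (x ^ degree P) ^ numeral k" for x :: complex and k
    by (simp add: mult.commute flip: power_mult)
  show ?thesis
    by (simp add: local_factor_def Let_def N_def Z_def W_def power_mult_distrib power_mult swap)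
qed

text \<open>Taking \<open>r\<close> with \<open>q = 1 / r ^ 3\<close> as parameter removes
  fractional exponents: in terms of \<open>b = r ^ d\<close> and \<open>u = \<zeta> ^ d\<close>, the
  quantities \<open>N\<close>, \<open>Z\<close>, \<open>W\<close> become \<open>1 / b ^ 3\<close>,
  \<open>b ^ 4 * u\<close>, \<open>b * u\<close>.\<close>

lemma local_factor_on_critical_circle:
  fixes P :: "'a::{finite,field} poly" and r :: real and \<zeta> :: complex
  assumes r: "0 < r" "r < 1" and q: "real CARD('a) = 1 / r ^ 3" and zeta: "\<zeta> ^ 3 = 1"
    and d: "degree P > 0"
  defines "D \<equiv> local_factor P (of_real r ^ 4 * \<zeta>) (of_nat CARD('a) * (of_real r ^ 4 * \<zeta>))"
  shows "D \<noteq> 0" and "norm (D - 1) \<le> 4 / (1 - r) ^ 2 * (r ^ 4) ^ degree P"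
proof -
  define a where "a = r ^ degree P"
  define u where "u = \<zeta> ^ degree P"
  define b where "b = complex_of_real a"
  have a: "0 < a" "a < 1" "a \<le> r"
    using r d power_decreasing[of 1 "degree P" r] by (auto simp: a_def power_less_one_iff)
  have b: "b \<noteq> 0" using a by (simp add: b_def)
  have nb: "norm b = a" using a by (simp add: b_def)
  have u3: "u ^ 3 = 1"
    by (metis u_def zeta power_mult mult.commute power_one)
  have nu: "norm u = 1"
    using u3 by (metis norm_one norm_power norm_ge_zero power_eq_1_iff zero_neq_numeral)
  then have "u \<noteq> 0" by auto
  have qc: "(of_nat CARD('a) :: complex) = 1 / of_real r ^ 3"
    using arg_cong[OF q, of complex_of_real] by simp
  have N: "poly_abs P = 1 / b ^ 3"
    by (simp add: poly_abs_def qc b_def a_def power_divide flip: power_mult)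
       (simp add: mult.commute)
  have Z: "(of_real r ^ 4 * \<zeta>) ^ degree P = b ^ 4 * u"
    by (simp add: u_def b_def a_def power_mult_distrib flip: power_mult) (simp add: mult.commute)
  have w: "of_nat CARD('a) * (of_real r ^ 4 * \<zeta>) = of_real r * \<zeta>"
    using r by (simp add: qc divide_simps power_numeral_reduce)
  have W: "(of_real r * \<zeta>) ^ degree P = b * u"
    by (simp add: u_def b_def a_def power_mult_distrib)
  have ne1: "u - b ^ 2 \<noteq> 0"
  proof
    assume "u - b ^ 2 = 0"
    then have "norm u = a ^ 2" using nb by (simp add: norm_power)
    then show False using nu a by (simp add: power2_eq_square) (smt (verit) mult_less_cancel_left2)
  qed
  have ne2: "1 + b * u \<noteq> 0"
  proof
    assume "1 + b * u = 0"
    then have "b * u = - 1" by (simp add: eq_neg_iff_add_eq_0 add.commute)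
    then have "norm (b * u) = 1" by simp
    then show False using nb nu a by (simp add: norm_mult)
  qed
  \<comment> \<open>This additive form serves the estimate of \<open>D - 1\<close>: one
    \<open>b ^ 2\<close> comes from clearing the denominator, another from the size of the bracket.
    The product form derived from it serves \<open>D \<noteq> 0\<close>.\<close>
  have D: "D = 1 + b ^ 2 * (- (b ^ 2 * u ^ 2) + b ^ 3 + (b ^ 7 - b ^ 4) * u) / ((u - b ^ 2) * (1 + b * u))"
  proof -
    let ?Z = "b ^ 4 * u" and ?W = "b * u"
    have "D = 1 + 1 / (((1 / b ^ 3) ^ 2 * ?Z - 1) * (1 + ?W)) *
        (- (?W ^ 2) - ?W ^ 3 / (1 / b ^ 3) + ?W / ((1 / b ^ 3) ^ 2 * ?Z) + 1 / b ^ 3 * (?W ^ 2 * ?Z)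
         + ?W ^ 2 * ?Z - (1 / b ^ 3) ^ 2 * (?W * ?Z ^ 2) + ?W ^ 3 * ?Z
         - (1 / b ^ 3) ^ 2 * (?W ^ 2 * ?Z ^ 2))"
      unfolding D_def local_factor_eq N w Z W ..
    also have "(1 / b ^ 3) ^ 2 * ?Z - 1 = (u - b ^ 2) / b ^ 2"
      using b by (simp add: field_simps power_numeral_reduce)
    \<comment> \<open>The terms in \<open>b ^ 6 * u ^ 3\<close> and in \<open>b ^ 3 * u ^ 3\<close>
      cancel in pairs; \<open>u ^ 3 = 1\<close> then reduces the two remaining fourth powers of
      \<open>u\<close>.\<close>
    also have "- (?W ^ 2) - ?W ^ 3 / (1 / b ^ 3) + ?W / ((1 / b ^ 3) ^ 2 * ?Z) + 1 / b ^ 3 * (?W ^ 2 * ?Z)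
         + ?W ^ 2 * ?Z - (1 / b ^ 3) ^ 2 * (?W * ?Z ^ 2) + ?W ^ 3 * ?Z
         - (1 / b ^ 3) ^ 2 * (?W ^ 2 * ?Z ^ 2)
       = - (b ^ 2 * u ^ 2) - b ^ 6 * u ^ 3 + b ^ 3 + b ^ 3 * u ^ 3 + b ^ 6 * u ^ 3 - b ^ 3 * u ^ 3
         + b ^ 7 * (u ^ 3 * u) - b ^ 4 * (u ^ 3 * u)"
      using b \<open>u \<noteq> 0\<close> by (simp add: field_simps power_numeral_reduce)
    also have "\<dots> = - (b ^ 2 * u ^ 2) + b ^ 3 + (b ^ 7 - b ^ 4) * u"
      unfolding u3 by (simp add: algebra_simps)
    finally show ?thesis by simp
  qed
  have "D = (1 - b ^ 3) * u * (1 - b ^ 6 + b * u - b ^ 2 * u ^ 2) / ((u - b ^ 2) * (1 + b * u))"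
  proof -
    \<comment> \<open>The constant \<open>b ^ 2\<close> is written as \<open>b ^ 2 * u ^ 3\<close>
      so that a factor \<open>u\<close> can be pulled out.\<close>
    have "(u - b ^ 2) * (1 + b * u) + b ^ 2 * (- (b ^ 2 * u ^ 2) + b ^ 3 + (b ^ 7 - b ^ 4) * u)
        = (1 - b ^ 3) * (u * (1 - b ^ 6) + b * u ^ 2 - b ^ 2 * u ^ 3)"
      unfolding u3 by (simp add: algebra_simps power_numeral_reduce)
    also have "\<dots> = (1 - b ^ 3) * u * (1 - b ^ 6 + b * u - b ^ 2 * u ^ 2)"
      by (simp add: algebra_simps power_numeral_reduce)
    finally show ?thesis
      unfolding D using ne1 ne2 by (simp add: add_divide_eq_iff)
  qed
  moreover have "1 - b ^ 3 \<noteq> 0"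
  proof -
    have "a ^ 3 < 1" using a by (simp add: power_less_one_iff)
    then have "complex_of_real (1 - a ^ 3) \<noteq> 0" by (simp only: of_real_eq_0_iff)
    then show ?thesis by (simp add: b_def)
  qed
  moreover have "1 - b ^ 6 + b * u - b ^ 2 * u ^ 2 \<noteq> 0"
    unfolding b_def using a u3 by (intro euler_factor_numerator_nonzero)
  ultimately show "D \<noteq> 0" using \<open>u \<noteq> 0\<close> ne1 ne2 by simp

  have "norm (- (b ^ 2 * u ^ 2) + b ^ 3 + (b ^ 7 - b ^ 4) * u) \<le> a ^ 2 + a ^ 3 + (a ^ 7 + a ^ 4)"
  proof -
    have "norm (- (b ^ 2 * u ^ 2)) = a ^ 2" "norm (b ^ 3) = a ^ 3"
      by (simp_all add: norm_mult norm_power nb nu)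
    moreover have "norm ((b ^ 7 - b ^ 4) * u) \<le> a ^ 7 + a ^ 4"
      using norm_triangle_ineq4[of "b ^ 7" "b ^ 4"] by (simp add: norm_mult norm_power nb nu)
    ultimately show ?thesis
      by (intro norm_triangle_le add_mono) auto
  qed
  also have "\<dots> \<le> 4 * a ^ 2"
  proof -
    have "a ^ 3 \<le> a ^ 2" "a ^ 4 \<le> a ^ 2" "a ^ 7 \<le> a ^ 2"
      using a by (auto intro!: power_decreasing)
    then show ?thesis by linarith
  qed
  finally have num: "norm (- (b ^ 2 * u ^ 2) + b ^ 3 + (b ^ 7 - b ^ 4) * u) \<le> 4 * a ^ 2" .
  \<comment> \<open>Since the degree is positive, \<open>a \<le> r\<close>, so both factors of the
    denominator stay at least \<open>1 - r\<close> away from 0, uniformly in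
    \<open>P\<close>.\<close>
  have "1 - r \<le> norm (u - b ^ 2)"
  proof -
    have "norm u - norm (b ^ 2) \<le> norm (u - b ^ 2)" by (rule norm_triangle_ineq2)
    moreover have "a ^ 2 \<le> r" using power_decreasing[of 1 2 a] a by simp
    ultimately show ?thesis using nu nb by (simp add: norm_power)
  qed
  moreover have "1 - r \<le> norm (1 + b * u)"
    using norm_diff_ineq[of 1 "b * u"] nu nb a by (simp add: norm_mult)
  ultimately have den: "(1 - r) ^ 2 \<le> norm ((u - b ^ 2) * (1 + b * u))"
    using r by (simp add: power2_eq_square norm_mult mult_mono)
  have "norm (D - 1) = a ^ 2 * norm (- (b ^ 2 * u ^ 2) + b ^ 3 + (b ^ 7 - b ^ 4) * u)
      / norm ((u - b ^ 2) * (1 + b * u))"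
    unfolding D by (simp add: norm_mult norm_divide norm_power nb)
  also have "\<dots> \<le> a ^ 2 * (4 * a ^ 2) / (1 - r) ^ 2"
    using num den r a by (intro frac_le mult_mono mult_nonneg_nonneg) auto
  also have "\<dots> = 4 / (1 - r) ^ 2 * a ^ 4"
    by (simp add: power2_eq_square power4_eq_xxxx)
  also have "a ^ 4 = (r ^ 4) ^ degree P"
    by (simp add: a_def mult.commute flip: power_mult)
  finally show "norm (D - 1) \<le> 4 / (1 - r) ^ 2 * (r ^ 4) ^ degree P" .
qed

section \<open>The cube root of unity and the value of \<open>Phi\<close> at
  \<open>z1\<close>\<close>

lemma omega_cube: "omega ^ 3 = 1"
  using exp_two_pi_i by (simp add: omega_def mult_ac flip: exp_of_nat_mult)

lemma norm_omega: "norm omega = 1"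
  by (simp add: omega_def)

lemma omega_eq: "omega = Complex (- 1 / 2) (sqrt 3 / 2)"
proof -
  have "omega = cis (2 * pi / 3)"
    by (simp add: omega_def cis_conv_exp mult_ac)
  then show ?thesis
    by (simp add: complex_eq_iff cos_120 sin_120)
qed

lemma omega_power_mod: "omega ^ (n + 1) = omega ^ (n mod 3 + 1)"
proof -
  have "omega ^ n = omega ^ (3 * (n div 3) + n mod 3)" by simp
  also have "\<dots> = omega ^ (n mod 3)"
    unfolding power_add power_mult omega_cube by simp
  finally show ?thesis by simp
qed

text \<open>Besides the product, four elementary factors must not vanish. Absolute values decide:
  \<open>q * z\<close>, \<open>q ^ 3 * z ^ 2\<close>, \<open>z\<close> and \<open>q ^ 2 * z\<close>
  have norms \<open>r\<close>, \<open>1 / r\<close>, \<open>r ^ 4\<close> and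
  \<open>1 / r ^ 2\<close>, none equal to 1.\<close>

lemma Phi_z1_nonzero: "Phi TYPE('a::{finite,field}) (z1 TYPE('a)) \<noteq> 0"
proof -
  define q where "q = real CARD('a)"
  define r where "r = q powr (- 1 / 3)"
  have "CARD('a) \<ge> 2"
    using card_mono[of UNIV "{0, 1 :: 'a}"] by simp
  then have q: "q \<ge> 2" by (simp add: q_def)
  have r: "0 < r" "r < 1"
    using q by (auto simp: r_def intro!: powr_less_one)
  have r3: "r ^ 3 = 1 / q" 
  proof -
    have "r ^ 3 = q powr (- 1)" using q by (simp add: r_def powr_power)
    then show ?thesis using q by (simp add: powr_minus_divide)
  qed
  have r4: "q powr (- 4 / 3) = r ^ 4"
    using q by (simp add: r_def powr_power)
  have qr: "q = 1 / r ^ 3" using r3 by simp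
  define z where "z = z1 TYPE('a)"
  have z: "z = of_real r ^ 4 * omega"
    unfolding z_def z1_def q_def[symmetric] r4 by simp
  have nz: "norm z = r ^ 4" using r by (simp add: z norm_mult norm_power norm_omega)
  let ?q = "of_nat CARD('a) :: complex"
  have nq: "norm ?q = 1 / r ^ 3" using qr q_def by simp
  let ?f = "\<lambda>P. local_factor P z (?q * z)"
  let ?A = "monic_irreducibles :: 'a poly set"
  have deg: "degree P > 0" if "P \<in> ?A" for P
    using that by (auto simp: monic_irreducibles_def irreducible_def is_unit_iff_degree intro!: Nat.gr0I)
  note lf = local_factor_on_critical_circle[OF r qr[unfolded q_def] omega_cube, folded z]
  have "(\<lambda>P. (r ^ 4) ^ degree P) summable_on {P :: 'a poly. lead_coeff P = 1}"
  proof (rule summable_on_monic)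
    have "real CARD('a) * r ^ 4 = r"
      using r by (simp add: qr[unfolded q_def] power_numeral_reduce)
    then show "real CARD('a) * r ^ 4 < 1" using r by simp
  qed (use r in simp)
  then have "(\<lambda>P. 4 / (1 - r) ^ 2 * (r ^ 4) ^ degree P) summable_on ?A"
    by (intro summable_on_cmult_right) (erule summable_on_subset_banach, auto simp: monic_irreducibles_def)
  then have "(\<lambda>P. norm (?f P - 1)) summable_on ?A"
    by (rule summable_on_comparison_test) (use deg lf(2) in auto)
  then have prod: "unordered_prod ?f ?A \<noteq> 0"
    using deg lf(1) by (intro unordered_prod_nonzero) auto
  have "1 - 1 / (?q * z) \<noteq> 0"
  proof
    assume "1 - 1 / (?q * z) = 0"
    then have "?q * z = 1" by (auto simp: divide_simps split: if_splits)
    then have "norm ?q * norm z = 1" by (metis norm_mult norm_one)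
    moreover have "norm ?q * norm z = r" unfolding nq nz using r by (simp add: power_numeral_reduce)
    ultimately show False using r by simp
  qed
  moreover have "1 - ?q ^ 3 * z ^ 2 \<noteq> 0"
  proof
    assume "1 - ?q ^ 3 * z ^ 2 = 0"
    then have "norm ?q ^ 3 * norm z ^ 2 = 1" by (metis norm_mult norm_one norm_power eq_iff_diff_eq_0)
    moreover have "norm ?q ^ 3 * norm z ^ 2 = 1 / r"
      unfolding nq nz using r by (simp add: power_numeral_reduce)
    ultimately show False using r by simp
  qed
  \<comment> \<open>The denominators matter as well: division by zero would give \<open>Phi\<close>
    the value 0.\<close>
  moreover have "1 - z \<noteq> 0"
  proof
    assume "1 - z = 0"
    then have "norm z = 1" by auto
    then show False using r power_less_one_iff[of r 4] by (simp add: nz)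
  qed
  moreover have "1 - ?q ^ 2 * z \<noteq> 0"
  proof
    assume "1 - ?q ^ 2 * z = 0"
    then have "norm ?q ^ 2 * norm z = 1" by (metis norm_mult norm_one norm_power eq_iff_diff_eq_0)
    moreover have "norm ?q ^ 2 * norm z = 1 / r ^ 2"
      unfolding nq nz using r by (simp add: power_numeral_reduce)
    ultimately show False using r power_less_one_iff[of r 2] by simp
  qed
  ultimately have "Phi TYPE('a) z \<noteq> 0"
    using prod by (simp add: Phi_def Let_def)
  then show ?thesis by (simp add: z_def)
qed

section \<open>Growth along residue classes modulo 3\<close>

text \<open>For purely imaginary \<open>x\<close> the two real parts are \<open>Im x\<close> times
  minus and plus \<open>sqrt 3 / 2\<close>.\<close>

lemma Re_omega_rotation_nonzero:
  fixes x :: complex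
  assumes "x \<noteq> 0" "Re x = 0"
  shows "Re (x * omega) \<noteq> 0" "Re (x * omega ^ 2) \<noteq> 0"
proof -
  have "Im x \<noteq> 0" using assms by (auto simp: complex_eq_iff)
  then show "Re (x * omega) \<noteq> 0" "Re (x * omega ^ 2) \<noteq> 0"
    using assms by (auto simp: omega_eq power2_eq_square)
qed

lemma S_nr_lower_bound:
  assumes "Re (omega ^ (m + 1) * Phi TYPE('a::{finite,field}) (z1 TYPE('a))) \<noteq> 0" "m < 3"
  shows "\<exists>c::real. c > 0 \<and> (\<forall>\<^sub>F g in sequentially. g mod 3 = m \<longrightarrow>
    \<bar>S_nr TYPE('a) g\<bar> \<ge> c * real g * real CARD('a) powr (2 * real g / 3))"
proof -
  let ?q = "real CARD('a)"
  define K where "K = 2 * ?q powr (- 1 / 3) / 9"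
  define \<beta> where "\<beta> = Re (omega ^ (m + 1) * Phi TYPE('a) (z1 TYPE('a)))"
  define \<delta> where "\<delta> = Re (omega ^ (m + 1) * (2 * z1 TYPE('a) * deriv (Phi TYPE('a)) (z1 TYPE('a))))"
  have K: "K > 0" by (simp add: K_def)
  have \<beta>: "\<bar>\<beta>\<bar> > 0" using assms by (simp add: \<beta>_def)
  have Re_eq: "Re (w * (x - of_nat n * y)) = Re (w * x) - real n * Re (w * y)" for w x y n
    by (simp add: algebra_simps)
  \<comment> \<open>On a fixed class \<open>omega ^ (g + 1)\<close> is constant, so the real part is
    affine in \<open>g\<close> with slope \<open>-\<beta>\<close>; the derivative enters only
    through the fixed number \<open>\<delta>\<close>.\<close>
  have S: "S_nr TYPE('a) g = K * ?q powr (2 * real g / 3) * (\<delta> - real (g + 1) * \<beta>)"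
    if "g mod 3 = m" for g
  proof -
    have "omega ^ (g + 1) = omega ^ (m + 1)" using omega_power_mod[of g] that by simp
    moreover have "?q powr (2 * real g / 3 - 1 / 3) = ?q powr (2 * real g / 3) * ?q powr (- 1 / 3)"
      by (simp flip: powr_add)
    ultimately show ?thesis
      unfolding S_nr_def K_def \<beta>_def \<delta>_def by (simp only: Re_eq) simp
  qed
  have "\<forall>\<^sub>F g in sequentially. g mod 3 = m \<longrightarrow>
      K * \<bar>\<beta>\<bar> / 2 * real g * ?q powr (2 * real g / 3) \<le> \<bar>S_nr TYPE('a) g\<bar>"
    \<comment> \<open>Beyond this threshold \<open>\<bar>\<delta>\<bar>\<close> is at most half of
      \<open>g * \<bar>\<beta>\<bar>\<close>, so at least half of the main term survives; hence the
      constant \<open>K * \<bar>\<beta>\<bar> / 2\<close>.\<close>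
    using eventually_ge_at_top[of "nat \<lceil>2 * \<bar>\<delta>\<bar> / \<bar>\<beta>\<bar>\<rceil>"]
  proof eventually_elim
    case (elim g)
    show ?case
    proof
      assume g: "g mod 3 = m"
      have "2 * \<bar>\<delta>\<bar> / \<bar>\<beta>\<bar> \<le> real g" using elim by linarith
      then have "2 * \<bar>\<delta>\<bar> \<le> real g * \<bar>\<beta>\<bar>" using \<beta> by (simp add: field_simps)
      moreover have "real (g + 1) * \<bar>\<beta>\<bar> - \<bar>\<delta>\<bar> \<le> \<bar>\<delta> - real (g + 1) * \<beta>\<bar>"
        using abs_triangle_ineq2[of "real (g + 1) * \<beta>" \<delta>]
        by (simp add: abs_mult abs_minus_commute)
      moreover have "t / 2 * x \<le> y" if "2 * d \<le> x * t" "(x + 1) * t - d \<le> y" "t > 0"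
        for t x d y :: real
        using that by (simp add: algebra_simps)
      ultimately have "\<bar>\<beta>\<bar> / 2 * real g \<le> \<bar>\<delta> - real (g + 1) * \<beta>\<bar>"
        using \<beta> by (metis of_nat_add of_nat_1)
      then have "K * ?q powr (2 * real g / 3) * (\<bar>\<beta>\<bar> / 2 * real g)
          \<le> K * ?q powr (2 * real g / 3) * \<bar>\<delta> - real (g + 1) * \<beta>\<bar>"
        using K by (intro mult_left_mono) auto
      then show "K * \<bar>\<beta>\<bar> / 2 * real g * ?q powr (2 * real g / 3) \<le> \<bar>S_nr TYPE('a) g\<bar>"
        using K by (simp add: S[OF g] abs_mult mult_ac)
    qed
  qed
  then show ?thesis
    using K \<beta> by (intro exI[of _ "K * \<bar>\<beta>\<bar> / 2"]) auto
qed

theorem proposition4p5: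
  fixes q :: nat
  assumes "q = CARD('a::{finite,field})" and "odd q"
  shows "card {m \<in> {0, 1, 2::nat}. \<exists>c::real. c > 0 \<and>
            (\<forall>\<^sub>F g in sequentially. g mod 3 = m \<longrightarrow>
               \<bar>S_nr TYPE('a) g\<bar> \<ge> c * real g * real q powr (2 * real g / 3))} \<ge> 2
       \<and> (\<exists>g\<ge>1. S_nr TYPE('a) g \<noteq> 0)"
proof
  let ?good = "\<lambda>m. \<exists>c::real. c > 0 \<and> (\<forall>\<^sub>F g in sequentially. g mod 3 = m \<longrightarrow>
    \<bar>S_nr TYPE('a) g\<bar> \<ge> c * real g * real q powr (2 * real g / 3))"
  let ?\<Phi> = "Phi TYPE('a) (z1 TYPE('a))"
  define R where "R m = Re (omega ^ (m + 1) * ?\<Phi>)" for m :: nat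
  have good: "?good m" if "m < 3" "R m \<noteq> 0" for m
    using S_nr_lower_bound[where 'a='a, of m] that assms(1) by (simp add: R_def)
  \<comment> \<open>If \<open>R m = 0\<close>, the nonzero number \<open>?x\<close> is purely
    imaginary and its rotations are not. Hence at most one of \<open>R 0\<close>,
    \<open>R 1\<close>, \<open>R 2\<close> vanishes.\<close>
  have rot: "R m \<noteq> 0 \<or> R (m + 1) \<noteq> 0" "R m \<noteq> 0 \<or> R (m + 2) \<noteq> 0" for m
  proof -
    let ?x = "omega ^ (m + 1) * ?\<Phi>"
    have "omega \<noteq> 0" using norm_omega by auto
    then have "?x \<noteq> 0" using Phi_z1_nonzero[where 'a='a] by simp
    then show "R m \<noteq> 0 \<or> R (m + 1) \<noteq> 0" "R m \<noteq> 0 \<or> R (m + 2) \<noteq> 0"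
      using Re_omega_rotation_nonzero[of ?x]
      by (auto simp: R_def power2_eq_square mult_ac simp del: times_complex.sel)
  qed
  have "R 0 \<noteq> 0 \<or> R 1 \<noteq> 0" "R 0 \<noteq> 0 \<or> R 2 \<noteq> 0" "R 1 \<noteq> 0 \<or> R 2 \<noteq> 0"
    using rot(1)[of 0] rot(2)[of 0] rot(1)[of 1] by (simp_all add: numeral_2_eq_2)
  then obtain m n where mn: "m \<noteq> n" "m \<in> {0,1,2}" "n \<in> {0,1,2}" "R m \<noteq> 0" "R n \<noteq> 0"
    using that[of 0 1] that[of 0 2] that[of 1 2] by auto
  then have gm: "?good m" "?good n" by (auto intro!: good)
  have "card {m, n} \<le> card {m \<in> {0, 1, 2::nat}. ?good m}"
    using mn gm by (intro card_mono) auto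
  then show "card {m \<in> {0, 1, 2::nat}. ?good m} \<ge> 2"
    using mn by simp
  from gm(1) obtain c G where c: "c > 0"
    and G: "\<And>g. g \<ge> G \<Longrightarrow> g mod 3 = m \<Longrightarrow> c * real g * real q powr (2 * real g / 3) \<le> \<bar>S_nr TYPE('a) g\<bar>"
    unfolding eventually_sequentially by blast
  \<comment> \<open>The summand \<open>G + 1\<close>, rather than \<open>G\<close>, keeps
    \<open>g\<close> positive even when \<open>G\<close> and \<open>m\<close> are both 0.\<close>
  define g where "g = 3 * (G + 1) + m"
  have "g mod 3 = m" using mn by (auto simp: g_def)
  moreover have g: "g \<ge> G" "g \<ge> 1" by (auto simp: g_def)
  moreover have "q > 0" using assms by auto
  ultimately have "0 < \<bar>S_nr TYPE('a) g\<bar>"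
    using c by (intro less_le_trans[OF _ G]) auto
  then show "\<exists>g\<ge>1. S_nr TYPE('a) g \<noteq> 0"
    using g by (intro exI[of _ g]) simp
qed

end
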